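(* Let $R$ be a commutative ring with identity. (1) Let $I \subseteq J$ be ideals of $R$. If $P$ is an $I$-prime ideal of $R$, then $P$ is $J$-prime. (2) Let $I$ be an ideal of $R$ and let $P$ be an $I$-prime ideal of $R$ that is not prime. Then $P^{2} \subseteq IP$. Thus, an $I$-prime ideal $P$ with $P^{2} \nsubseteq IP$ is prime.
   Context: All rings are commutative with identity. For an ideal $I$ of a ring $R$, a proper ideal $P$ of $R$ is called $I$-prime if for all $a, b \in R$, $ab \in P - IP$ (that is, $ab \in P$ and $ab \notin IP$) implies $a \in P$ or $b \in P$. Here $IP$ is the product of the ideals $I$ and $P$. *)

theory Defs
  imports "HOL-Algebra.Ideal_Product"
begin

text \<open>
  The parameter \<open>I\<close> is meant to be an ideal of \<open>R\<close>; this is not part of the predicate and has to be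
  assumed where it is used.
\<close>

definition I_prime_ideal :: "('a, 'b) ring_scheme \<Rightarrow> 'a set \<Rightarrow> 'a set \<Rightarrow> bool" where
  "I_prime_ideal R I P \<longleftrightarrow>
     ideal P R \<and> P \<noteq> carrier R \<and>
     (\<forall>a\<in>carrier R. \<forall>b\<in>carrier R.
        a \<otimes>\<^bsub>R\<^esub> b \<in> P - I \<cdot>\<^bsub>R\<^esub> P \<longrightarrow> a \<in> P \<or> b \<in> P)"

end

theory Submission
  imports Defs
begin

text \<open>
  Both parts depend on the set \<open>I \<cdot> P\<close> of elements excused from the primeness condition.

  Enlarging \<open>I\<close> enlarges this set, so the condition becomes weaker; that is the first part.

  For the second part, let \<open>P\<close> fail to be prime. Then there are \<open>a, b \<notin> P\<close> with \<open>a \<otimes> b \<in> P\<close>. Adding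
  elements \<open>p, q\<close> of \<open>P\<close> to \<open>a\<close> and \<open>b\<close> changes neither fact, so all four products \<open>a \<otimes> b\<close>,
  \<open>a \<otimes> (b \<oplus> q)\<close>, \<open>(a \<oplus> p) \<otimes> b\<close> and \<open>(a \<oplus> p) \<otimes> (b \<oplus> q)\<close> are violations of primeness and must be
  excused, that is, lie in \<open>I \<cdot> P\<close>. Expanding them isolates first \<open>a \<otimes> q\<close> and \<open>p \<otimes> b\<close>, then
  \<open>p \<otimes> q\<close>, as elements of \<open>I \<cdot> P\<close>. This is \<open>mult_mem_of_nonprime_witness\<close>, with an ideal \<open>K\<close>
  of excused elements in place of \<open>I \<cdot> P\<close>. Since the products \<open>p \<otimes> q\<close> generate \<open>P \<cdot> P\<close>, the
  inclusion follows.
\<close>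

lemma ideal_prod_mono_left:
  assumes "I \<subseteq> J"
  shows "I \<cdot>\<^bsub>R\<^esub> P \<subseteq> J \<cdot>\<^bsub>R\<^esub> P"
proof
  fix s assume "s \<in> I \<cdot>\<^bsub>R\<^esub> P"
  thus "s \<in> J \<cdot>\<^bsub>R\<^esub> P"
    by induct (use assms in \<open>auto intro: ideal_prod.intros\<close>)
qed

lemma (in ring) ideal_prod_least:
  assumes "ideal K R" and "\<And>i j. i \<in> I \<Longrightarrow> j \<in> J \<Longrightarrow> i \<otimes> j \<in> K"
  shows "I \<cdot> J \<subseteq> K"
proof
  fix s assume "s \<in> I \<cdot> J"
  thus "s \<in> K"
    by induct
      (use assms in \<open>auto intro: additive_subgroup.a_closed ideal.axioms(1)\<close>)
qed

lemma (in ring) ideal_add_cancel_left: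
  assumes K: "ideal K R" and "x \<in> K" and "y \<in> carrier R"
  shows "x \<oplus> y \<in> K \<longleftrightarrow> y \<in> K"
proof
  interpret K: ideal K R by (rule K)
  have x: "x \<in> carrier R" using \<open>x \<in> K\<close> by (rule K.Icarr)
  {
    assume "x \<oplus> y \<in> K"
    with \<open>x \<in> K\<close> have "\<ominus> x \<oplus> (x \<oplus> y) \<in> K" by simp
    thus "y \<in> K" using x \<open>y \<in> carrier R\<close> by (simp add: r_neg1)
  next
    assume "y \<in> K"
    with \<open>x \<in> K\<close> show "x \<oplus> y \<in> K" by simp
  }
qed

text \<open>
  The pair \<open>a, b\<close> witnesses that \<open>P\<close> is not prime, and so does every pair congruent to it modulo
  \<open>P\<close>. The products of all these pairs lie in \<open>K\<close>, and \<open>p \<otimes> q\<close> is an alternating sum of four of them.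
\<close>

lemma (in cring) mult_mem_of_nonprime_witness:
  assumes P: "ideal P R" and K: "ideal K R"
    and prime_off_K: "\<And>a b. \<lbrakk>a \<in> carrier R; b \<in> carrier R; a \<otimes> b \<in> P - K\<rbrakk> \<Longrightarrow> a \<in> P \<or> b \<in> P"
    and a: "a \<in> carrier R" "a \<notin> P" and b: "b \<in> carrier R" "b \<notin> P" and ab: "a \<otimes> b \<in> P"
    and p: "p \<in> P" and q: "q \<in> P"
  shows "p \<otimes> q \<in> K"
proof -
  interpret P: ideal P R by (rule P)
  note [simp] = a(1) b(1) P.Icarr[OF p] P.Icarr[OF q]
  have shift: "(a \<oplus> x) \<otimes> (b \<oplus> y) \<in> K" if x: "x \<in> P" and y: "y \<in> P" for x y
  proof -
    note [simp] = P.Icarr[OF x] P.Icarr[OF y]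
    have "a \<oplus> x \<notin> P"
      using a ideal_add_cancel_left[OF P x, of a] by (simp add: a_comm)
    moreover have "b \<oplus> y \<notin> P"
      using b ideal_add_cancel_left[OF P y, of b] by (simp add: a_comm)
    moreover have "(a \<oplus> x) \<otimes> (b \<oplus> y) = a \<otimes> b \<oplus> (a \<otimes> y \<oplus> x \<otimes> (b \<oplus> y))"
      by (simp add: l_distr r_distr a_ac)
    then have "(a \<oplus> x) \<otimes> (b \<oplus> y) \<in> P"
      using ab x y by (simp add: P.I_l_closed P.I_r_closed)
    ultimately show ?thesis
      using prime_off_K[of "a \<oplus> x" "b \<oplus> y"] by auto
  qed
  have abK: "a \<otimes> b \<in> K"
    using shift[of \<zero> \<zero>] by simp
  have "a \<otimes> b \<oplus> a \<otimes> q \<in> K"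
    using shift[of \<zero> q] q by (simp add: r_distr)
  then have aqK: "a \<otimes> q \<in> K"
    using ideal_add_cancel_left[OF K abK] by simp
  have "a \<otimes> b \<oplus> p \<otimes> b \<in> K"
    using shift[of p \<zero>] p by (simp add: l_distr)
  then have pbK: "p \<otimes> b \<in> K"
    using ideal_add_cancel_left[OF K abK] by simp
  have "a \<otimes> b \<oplus> (a \<otimes> q \<oplus> (p \<otimes> b \<oplus> p \<otimes> q)) \<in> K"
    using shift[OF p q] by (simp add: l_distr r_distr a_ac)
  then show ?thesis
    using ideal_add_cancel_left[OF K abK] ideal_add_cancel_left[OF K aqK]
      ideal_add_cancel_left[OF K pbK] by simp
qed

lemma I_prime_ideal_mono:
  assumes "I_prime_ideal R I P" and "I \<subseteq> J"
  shows "I_prime_ideal R J P"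
  using assms ideal_prod_mono_left[of I J R P]
  unfolding I_prime_ideal_def by blast

lemma (in cring) I_prime_ideal_square_subset:
  assumes I: "ideal I R" and IP: "I_prime_ideal R I P" and "\<not> primeideal P R"
  shows "P \<cdot> P \<subseteq> I \<cdot> P"
proof -
  have P: "ideal P R" and proper: "carrier R \<noteq> P"
    and prime_off: "\<And>a b. \<lbrakk>a \<in> carrier R; b \<in> carrier R; a \<otimes> b \<in> P - I \<cdot> P\<rbrakk> \<Longrightarrow> a \<in> P \<or> b \<in> P"
    using IP unfolding I_prime_ideal_def by auto
  have K: "ideal (I \<cdot> P) R"
    using I P by (rule ideal_prod_is_ideal)
  obtain a b where "a \<in> carrier R" "b \<in> carrier R" "a \<otimes> b \<in> P" "a \<notin> P" "b \<notin> P"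
    using \<open>\<not> primeideal P R\<close> primeidealI[OF P is_cring proper] by blast
  with mult_mem_of_nonprime_witness[OF P K prime_off]
  have "p \<otimes> q \<in> I \<cdot> P" if "p \<in> P" "q \<in> P" for p q
    using that by blast
  with K show ?thesis
    by (rule ideal_prod_least)
qed

theorem theorem2p2:
  fixes R (structure)
  assumes "cring R"
  shows "(\<forall>I J P. ideal I R \<and> ideal J R \<and> I \<subseteq> J \<and> I_prime_ideal R I P \<longrightarrow> I_prime_ideal R J P)
       \<and> (\<forall>I P. ideal I R \<and> I_prime_ideal R I P \<and> \<not> primeideal P R \<longrightarrow> P \<cdot> P \<subseteq> I \<cdot> P)
       \<and> (\<forall>I P. ideal I R \<and> I_prime_ideal R I P \<and> \<not> P \<cdot> P \<subseteq> I \<cdot> P \<longrightarrow> primeideal P R)"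
  using I_prime_ideal_mono cring.I_prime_ideal_square_subset[OF assms] by blast

end
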